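(* For $t,b\in[0,1]$, the map $T_t\otimes\Pi_{\lambda_b}:\mathcal{M}_4\to\mathcal{M}_4$ is positive and not decomposable if and only if $t\le\frac1{2b}$ and $3<2b+t+2bt$. (Moreover, $T_t\otimes\Pi_{\lambda_b}$ is positive if and only if $t\le\frac1{2b}$.)
   Context: $T_t(X)=(1-t)\mathrm{Tr}(X)\frac{I_2}{2}+tX$ on $\mathcal{M}_2$. For $b\in[0,1]$, $\Pi_{\lambda_b}(X)=\mathrm{Tr}(X)\frac{I_2}2+\frac b2\big(\mathrm{Tr}(X\sigma_2)\sigma_2+\mathrm{Tr}(X\sigma_4)\sigma_4\big)$ with $\sigma_2=\begin{pmatrix}0&1\\1&0\end{pmatrix}$, $\sigma_4=\begin{pmatrix}0&-i\\i&0\end{pmatrix}$ (the Pauli diagonal map with parameter vector $(1,b,0,b)$). Decomposable means $T+\vartheta\circ S$ with $T,S$ completely positive, $\vartheta$ the transpose. *)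

theory Defs
  imports Complex_Main
begin

text \<open>Square complex matrices of size n are represented as functions
  nat => nat => complex; only entries with indices below n matter.\<close>
type_synonym cmat = "nat \<Rightarrow> nat \<Rightarrow> complex"

text \<open>A linear map M_n -> M_m is represented by its coefficient array K:
  the map sends X to the matrix with (i,j) entry sum over a,b<n of K i j a b * X a b.\<close>
type_synonym lmap = "nat \<Rightarrow> nat \<Rightarrow> nat \<Rightarrow> nat \<Rightarrow> complex"

definition qform :: "nat \<Rightarrow> cmat \<Rightarrow> (nat \<Rightarrow> complex) \<Rightarrow> complex" where
  "qform n A v = (\<Sum>i<n. \<Sum>j<n. cnj (v i) * A i j * v j)"

definition psd :: "nat \<Rightarrow> cmat \<Rightarrow> bool" where
  "psd n A \<longleftrightarrow> (\<forall>v. Im (qform n A v) = 0 \<and> 0 \<le> Re (qform n A v))"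

definition app :: "nat \<Rightarrow> lmap \<Rightarrow> cmat \<Rightarrow> cmat" where
  "app n K X = (\<lambda>i j. \<Sum>a<n. \<Sum>b<n. K i j a b * X a b)"

definition unit_mat :: "nat \<Rightarrow> nat \<Rightarrow> cmat" where
  "unit_mat a b = (\<lambda>x y. if x = a \<and> y = b then 1 else 0)"

definition kernel_of :: "(cmat \<Rightarrow> cmat) \<Rightarrow> lmap" where
  "kernel_of \<Phi> = (\<lambda>i j a b. \<Phi> (unit_mat a b) i j)"

definition positive_map :: "nat \<Rightarrow> nat \<Rightarrow> lmap \<Rightarrow> bool" where
  "positive_map n m K \<longleftrightarrow> (\<forall>X. psd n X \<longrightarrow> psd m (app n K X))"

text \<open>k-positivity: id_k tensor Phi is positive on M_k(M_n), block (a,b) of a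
  kn x kn matrix X being the n x n matrix with entries X (a*n+i) (b*n+j).\<close>
definition k_positive :: "nat \<Rightarrow> nat \<Rightarrow> nat \<Rightarrow> lmap \<Rightarrow> bool" where
  "k_positive k n m K \<longleftrightarrow>
     (\<forall>X. psd (k * n) X \<longrightarrow>
        psd (k * m) (\<lambda>p q. app n K (\<lambda>i j. X ((p div m) * n + i) ((q div m) * n + j))
                              (p mod m) (q mod m)))"

definition completely_positive :: "nat \<Rightarrow> nat \<Rightarrow> lmap \<Rightarrow> bool" where
  "completely_positive n m K \<longleftrightarrow> (\<forall>k. k_positive k n m K)"

definition decomposable :: "nat \<Rightarrow> nat \<Rightarrow> lmap \<Rightarrow> bool" where
  "decomposable n m K \<longleftrightarrow>
     (\<exists>T S. completely_positive n m T \<and> completely_positive n m S \<and>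
        (\<forall>X i j. i < m \<longrightarrow> j < m \<longrightarrow> app n K X i j = app n T X i j + app n S X j i))"

text \<open>Tensor product of maps M_n1 -> M_m1 and M_n2 -> M_m2, acting on
  M_(n1 n2) -> M_(m1 m2) with Kronecker index convention p = i*m2 + k.\<close>
definition tensor_map :: "nat \<Rightarrow> nat \<Rightarrow> lmap \<Rightarrow> lmap \<Rightarrow> lmap" where
  "tensor_map n2 m2 K1 K2 = (\<lambda>p q r s.
     K1 (p div m2) (q div m2) (r div n2) (s div n2) * K2 (p mod m2) (q mod m2) (r mod n2) (s mod n2))"

definition mtrace :: "nat \<Rightarrow> cmat \<Rightarrow> complex" where
  "mtrace n A = (\<Sum>i<n. A i i)"

definition mmult :: "nat \<Rightarrow> cmat \<Rightarrow> cmat \<Rightarrow> cmat" where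
  "mmult n A B = (\<lambda>i j. \<Sum>k<n. A i k * B k j)"

definition id_mat :: cmat where
  "id_mat = (\<lambda>i j. if i = j then 1 else 0)"

definition sigma2 :: cmat where
  "sigma2 = (\<lambda>i j. if (i = 0 \<and> j = 1) \<or> (i = 1 \<and> j = 0) then 1 else 0)"

definition sigma4 :: cmat where
  "sigma4 = (\<lambda>i j. if i = 0 \<and> j = 1 then - \<i> else if i = 1 \<and> j = 0 then \<i> else 0)"

definition T_map :: "real \<Rightarrow> cmat \<Rightarrow> cmat" where
  "T_map t X = (\<lambda>i j. of_real (1 - t) * mtrace 2 X * id_mat i j / 2 + of_real t * X i j)"

definition Pi_map :: "real \<Rightarrow> cmat \<Rightarrow> cmat" where
  "Pi_map b X = (\<lambda>i j. mtrace 2 X * id_mat i j / 2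
      + of_real b / 2 * (mtrace 2 (mmult 2 X sigma2) * sigma2 i j
                         + mtrace 2 (mmult 2 X sigma4) * sigma4 i j))"

definition TPi :: "real \<Rightarrow> real \<Rightarrow> lmap" where
  "TPi t b = tensor_map 2 2 (kernel_of (T_map t)) (kernel_of (Pi_map b))"

end

(*
  All maps involved are diagonal for the Pauli matrices, so decomposability is a small linear
  programme in the weights of the Pauli Kraus operators. Its optimal primal solution gives the
  decomposition and its optimal dual solution gives a PPT witness whose value on the map is
  6 (3 - t - 2b - 2bt).
  Positivity is tested on rank-one inputs. Split the input into x, y and the test vector into
  u, w in C^2. The critical terms |<u,x><w,y>| and |<x,y><u,w>| are controlled by the
  Cauchy-Binet identity <u,x><w,y> - <u,y><w,x> = conj(det(u,w)) det(x,y) and by the Lagrange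
  identity |<x,y>|^2 + |det(x,y)|^2 = |x|^2 |y|^2.
*)
theory Submission
  imports Defs
begin

section \<open>Positive semidefinite matrices\<close>

lemma qform_rank_one: "qform n (\<lambda>i j. x i * cnj (x j)) v = of_real ((cmod (\<Sum>i<n. cnj (x i) * v i))\<^sup>2)"
  unfolding complex_norm_square qform_def
  by (simp add: sum_product mult_ac) (subst sum.swap, simp)

lemma psd_rank_one: "psd n (\<lambda>i j. x i * cnj (x j))"
  unfolding psd_def qform_rank_one by simp

text \<open>The test vector is written as a sum, so the case \<open>i = j\<close> is included and
  also yields diagonal entries.\<close>

lemma qform_two_points:
  assumes "i < n" "j < n"
  shows "qform n A (\<lambda>k. (if k = i then p else 0) + (if k = j then q else 0)) =
    cnj p * A i i * p + cnj p * A i j * q + cnj q * A j i * p + cnj q * A j j * q"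
proof -
  have c: "cnj ((if k = i then p else 0) + (if k = j then q else 0)) =
    (if k = i then cnj p else 0) + (if k = j then cnj q else 0)" for k by simp
  have "(\<Sum>l<n. cnj ((if k = i then p else 0) + (if k = j then q else 0)) * A k l *
      ((if l = i then p else 0) + (if l = j then q else 0))) =
      (if k = i then cnj p else 0) * (A k i * p + A k j * q) +
      (if k = j then cnj q else 0) * (A k i * p + A k j * q)" for k
    unfolding c using assms
    by (simp add: distrib_left distrib_right sum.distrib if_distrib[of "\<lambda>z. _ * z"] mult.assoc cong: if_cong)
  then have "qform n A (\<lambda>k. (if k = i then p else 0) + (if k = j then q else 0)) =
      (\<Sum>k<n. (if k = i then cnj p else 0) * (A k i * p + A k j * q) +
      (if k = j then cnj q else 0) * (A k i * p + A k j * q))"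
    unfolding qform_def by simp
  also have "\<dots> = cnj p * (A i i * p + A i j * q) + cnj q * (A j i * p + A j j * q)"
    using assms by (simp add: sum.distrib if_distrib[of "\<lambda>z. z * _"] cong: if_cong)
  finally show ?thesis by (simp add: algebra_simps)
qed

lemma psd_diagonal:
  assumes "psd n A" "i < n"
  shows "Im (A i i) = 0" "0 \<le> Re (A i i)"
proof -
  have "qform n A (\<lambda>k. (if k = i then 1 else 0) + (if k = i then 0 else 0)) = A i i"
    using qform_two_points[OF assms(2,2), of A 1 0] by simp
  then show "Im (A i i) = 0" "0 \<le> Re (A i i)"
    using assms(1) unfolding psd_def by metis+
qed

text \<open>Testing with e_i + e_j kills the imaginary part of \<open>A i j + A j i\<close>; testing
  with e_i + \<i> e_j kills the real part of \<open>A i j - A j i\<close>.\<close>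

lemma psd_hermitian:
  assumes "psd n A" "i < n" "j < n"
  shows "A j i = cnj (A i j)"
proof -
  note q = qform_two_points[OF assms(2,3), of A 1]
  have d: "Im (A i i) = 0" "Im (A j j) = 0" using psd_diagonal assms by auto
  have "Im (A i i + A i j + A j i + A j j) = 0"
  proof -
    have "qform n A (\<lambda>k. (if k = i then 1 else 0) + (if k = j then 1 else 0)) =
      A i i + A i j + A j i + A j j"
      using q[of 1] by simp
    then show ?thesis using assms(1) unfolding psd_def by metis
  qed
  moreover have "Im (A i i + A i j * \<i> - \<i> * A j i + A j j) = 0"
  proof -
    have "qform n A (\<lambda>k. (if k = i then 1 else 0) + (if k = j then \<i> else 0)) =
      A i i + A i j * \<i> - \<i> * A j i + A j j"
      using q[of \<i>] by (simp add: complex_eq_iff)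
    then show ?thesis using assms(1) unfolding psd_def by metis
  qed
  ultimately show ?thesis using d by (simp add: complex_eq_iff)
qed

lemma psd_zero_diagonal:
  assumes "psd n A" "i < n" "j < n" "A j j = 0"
  shows "A i j = 0"
proof (rule ccontr)
  assume nz: "A i j \<noteq> 0"
  \<comment> \<open>With \<open>A j j = 0\<close> the form at e_i + q e_j is affine in
    \<open>c\<close>; this \<open>c\<close> makes its real part \<open>- Re (A i i) - 2\<close>,
    which is negative.\<close>
  define c where "c = complex_of_real ((Re (A i i) + 1) / (cmod (A i j))\<^sup>2)"
  have h: "A j i = cnj (A i j)" using psd_hermitian[OF assms(1-3)] .
  define q where "q = - c * cnj (A i j)"
  have "qform n A (\<lambda>k. (if k = i then 1 else 0) + (if k = j then q else 0)) =
     A i i + A i j * q + cnj q * A j i"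
    using qform_two_points[OF assms(2,3), of A 1 q] assms(4) by simp
  also have "\<dots> = A i i - 2 * c * of_real ((cmod (A i j))\<^sup>2)"
    unfolding q_def h complex_norm_square by (simp add: c_def algebra_simps)
  also have "\<dots> = A i i - 2 * of_real (Re (A i i) + 1)"
    using nz unfolding c_def by (simp flip: of_real_mult)
  finally have "Re (A i i - 2 * of_real (Re (A i i) + 1)) \<ge> 0"
    using assms(1) unfolding psd_def by metis
  then show False using psd_diagonal[OF assms(1,2)] by simp
qed

text \<open>A Cholesky factorisation; the last row is eliminated by a Schur complement.\<close>
lemma psd_sum_rank_one:
  assumes "psd n A"
  shows "\<exists>V. \<forall>i<n. \<forall>j<n. A i j = (\<Sum>l<n. V l i * cnj (V l j))"
  using assms
proof (induction n arbitrary: A)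
  case 0
  then show ?case by simp
next
  case (Suc n)
  define d where "d = Re (A n n)"
  have d0: "0 \<le> d" and Ad: "A n n = of_real d"
    using psd_diagonal[OF Suc.prems, of n] by (auto simp: d_def complex_eq_iff)
  \<comment> \<open>If \<open>d = 0\<close>, division by zero makes \<open>x\<close> vanish, which
    is the right value because the last column of \<open>A\<close> is then zero.\<close>
  define x where "x = (\<lambda>i. A i n / of_real (sqrt d))"
  have herm: "A j i = cnj (A i j)" if "i < Suc n" "j < Suc n" for i j
    using psd_hermitian[OF Suc.prems] that by blast
  have xn: "x i * cnj (x n) = A i n" if "i < Suc n" for i
  proof (cases "d = 0")
    case True
    then show ?thesis using psd_zero_diagonal[OF Suc.prems that, of n] Ad by (simp add: x_def)
  next
    case False
    then show ?thesis using d0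
      by (simp add: x_def Ad real_div_sqrt flip: of_real_divide)
  qed
  define B where "B = (\<lambda>i j. A i j - x i * cnj (x j))"
  have Bn: "B i n = 0" "B n i = 0" if "i < Suc n" for i
  proof -
    show "B i n = 0" using xn[OF that] by (simp add: B_def)
    have "B n i = cnj (B i n)" using herm[OF that, of n] by (simp add: B_def)
    then show "B n i = 0" using \<open>B i n = 0\<close> by simp
  qed
  have "psd n B"
    unfolding psd_def
  proof (intro allI)
    fix v
    \<comment> \<open>The last row and column of \<open>B\<close> vanish, so the last coordinate of
      the test vector is free. For \<open>d\<close> nonzero it is chosen to make \<open>w\<close>
      orthogonal to \<open>x\<close>, so that \<open>B\<close> and \<open>A\<close> have the same
      form at \<open>w\<close>.\<close>
    define c where "c = - (\<Sum>i<n. cnj (x i) * v i) / cnj (x n)"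
    define w where "w = (\<lambda>i. if i = n then c else v i)"
    have "qform n B v = qform (Suc n) B w"
      unfolding qform_def using Bn by (simp add: w_def)
    also have "\<dots> = qform (Suc n) A w - qform (Suc n) (\<lambda>i j. x i * cnj (x j)) w"
      unfolding qform_def B_def by (simp add: algebra_simps sum_subtractf)
    also have "qform (Suc n) (\<lambda>i j. x i * cnj (x j)) w = 0"
    proof (cases "d = 0")
      case True
      then show ?thesis by (simp add: x_def qform_def)
    next
      case False
      then have "x n \<noteq> 0" using Ad d0 by (simp add: x_def)
      then have "(\<Sum>i<Suc n. cnj (x i) * w i) = 0" by (simp add: w_def c_def)
      then show ?thesis unfolding qform_rank_one by simp
    qed
    finally show "Im (qform n B v) = 0 \<and> 0 \<le> Re (qform n B v)"
      using Suc.prems unfolding psd_def by simp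
  qed
  then obtain V where V: "\<And>i j. i < n \<Longrightarrow> j < n \<Longrightarrow> B i j = (\<Sum>l<n. V l i * cnj (V l j))"
    using Suc.IH by blast
  \<comment> \<open>The vectors for \<open>B\<close> are extended by zero in coordinate
    \<open>n\<close>, and \<open>x\<close> is added as the new vector.\<close>
  define V' where "V' = (\<lambda>l i. if l = n then x i else if i = n then 0 else V l i)"
  have "A i j = (\<Sum>l<Suc n. V' l i * cnj (V' l j))" if "i < Suc n" "j < Suc n" for i j
  proof -
    have "B i j = (\<Sum>l<n. V' l i * cnj (V' l j))"
      using that V[of i j] Bn by (auto simp: V'_def less_Suc_eq)
    then show ?thesis by (simp add: V'_def B_def algebra_simps)
  qed
  then show ?case by blast
qed

lemma app_sum_matrices:
  "app n K (\<lambda>a b. \<Sum>l\<in>L. X l a b) i j = (\<Sum>l\<in>L. app n K (X l) i j)"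
  unfolding app_def sum_distrib_left
  by (simp add: sum.swap[of _ L])

lemma qform_sum_matrices: "qform n (\<lambda>i j. \<Sum>l\<in>L. X l i j) v = (\<Sum>l\<in>L. qform n (X l) v)"
  unfolding qform_def sum_distrib_left sum_distrib_right
  by (simp add: sum.swap[of _ L])

text \<open>The factorisation \<open>psd_sum_rank_one\<close> and linearity reduce every positive
  semidefinite input to rank-one inputs.\<close>

lemma positive_map_if_rank_one:
  assumes "\<And>x. psd m (app n K (\<lambda>a b. x a * cnj (x b)))"
  shows "positive_map n m K"
  unfolding positive_map_def
proof (intro allI impI)
  fix X assume "psd n X"
  then obtain V where V: "\<forall>i<n. \<forall>j<n. X i j = (\<Sum>l<n. V l i * cnj (V l j))"
    using psd_sum_rank_one by blast
  have "app n K X = app n K (\<lambda>a b. \<Sum>l<n. V l a * cnj (V l b))"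
    unfolding app_def using V by (intro ext sum.cong) auto
  then have "app n K X = (\<lambda>i j. \<Sum>l<n. app n K (\<lambda>a b. V l a * cnj (V l b)) i j)"
    by (simp add: app_sum_matrices fun_eq_iff)
  then show "psd m (app n K X)"
    using assms unfolding psd_def by (simp add: qform_sum_matrices sum_nonneg)
qed

section \<open>Complete positivity and sums of Kraus terms\<close>

definition kraus_map :: "cmat \<Rightarrow> lmap" where
  "kraus_map V = (\<lambda>i j a b. V i a * cnj (V j b))"

definition lmap_add :: "lmap \<Rightarrow> lmap \<Rightarrow> lmap" where
  "lmap_add K L = (\<lambda>i j a b. K i j a b + L i j a b)"

definition lmap_scale :: "real \<Rightarrow> lmap \<Rightarrow> lmap" where
  "lmap_scale c K = (\<lambda>i j a b. of_real c * K i j a b)"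

text \<open>Closure under sums and nonnegative scaling lets membership be read off from an
  expression. The same cone serves for completely positive maps and for dual witnesses.\<close>

inductive kraus_cone :: "lmap \<Rightarrow> bool" where
  kraus: "kraus_cone (kraus_map V)"
| add: "kraus_cone K \<Longrightarrow> kraus_cone L \<Longrightarrow> kraus_cone (lmap_add K L)"
| scale: "0 \<le> c \<Longrightarrow> kraus_cone K \<Longrightarrow> kraus_cone (lmap_scale c K)"

lemma tensor_kraus_map:
  "tensor_map n m (kraus_map V) (kraus_map W) =
     kraus_map (\<lambda>p r. V (p div m) (r div n) * W (p mod m) (r mod n))"
  by (simp add: tensor_map_def kraus_map_def fun_eq_iff)

text \<open>Bilinearity, through an induction in each argument, leaves two single Kraus terms, whose
  tensor product is again one.\<close>

lemma kraus_cone_tensor: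
  assumes "kraus_cone K" "kraus_cone L"
  shows "kraus_cone (tensor_map n m K L)"
  using assms
proof (induction K rule: kraus_cone.induct)
  case (kraus V)
  from kraus.prems show ?case
  proof (induction L rule: kraus_cone.induct)
    case (kraus W)
    then show ?case unfolding tensor_kraus_map by (rule kraus_cone.kraus)
  next
    case (add K L)
    moreover have "tensor_map n m (kraus_map V) (lmap_add K L) =
      lmap_add (tensor_map n m (kraus_map V) K) (tensor_map n m (kraus_map V) L)"
      by (simp add: tensor_map_def lmap_add_def algebra_simps fun_eq_iff)
    ultimately show ?case by (simp add: kraus_cone.add)
  next
    case (scale c K)
    moreover have "tensor_map n m (kraus_map V) (lmap_scale c K) =
      lmap_scale c (tensor_map n m (kraus_map V) K)"
      by (simp add: tensor_map_def lmap_scale_def algebra_simps fun_eq_iff)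
    ultimately show ?case by (simp add: kraus_cone.scale)
  qed
next
  case (add K K')
  moreover have "tensor_map n m (lmap_add K K') L =
    lmap_add (tensor_map n m K L) (tensor_map n m K' L)"
    by (simp add: tensor_map_def lmap_add_def algebra_simps fun_eq_iff)
  ultimately show ?case by (simp add: kraus_cone.add)
next
  case (scale c K)
  moreover have "tensor_map n m (lmap_scale c K) L = lmap_scale c (tensor_map n m K L)"
    by (simp add: tensor_map_def lmap_scale_def algebra_simps fun_eq_iff)
  ultimately show ?case by (simp add: kraus_cone.scale)
qed

section \<open>Block matrices and complete positivity of the Kraus cone\<close>

lemma sum_lessThan_mult:
  fixes f :: "nat \<Rightarrow> 'a::comm_monoid_add"
  shows "(\<Sum>p<k * m. f p) = (\<Sum>c<k. \<Sum>i<m. f (c * m + i))"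
proof -
  have "sum f {c * m..<c * m + m} = (\<Sum>i<m. f (c * m + i))" for c
    using sum.shift_bounds_nat_ivl[of f 0 "c * m" m] by (simp add: atLeast0LessThan add.commute)
  then show ?thesis by (simp flip: sum.nat_group)
qed

lemma qform_blocks:
  "qform (k * n) A v =
    (\<Sum>c<k. \<Sum>d<k. \<Sum>i<n. \<Sum>j<n. cnj (v (c * n + i)) * A (c * n + i) (d * n + j) * v (d * n + j))"
  unfolding qform_def sum_lessThan_mult by (intro sum.cong refl sum.swap)

lemma sum_swap_pairs:
  "(\<Sum>i\<in>I. \<Sum>j\<in>J. \<Sum>a\<in>A. \<Sum>b\<in>B. f i j a b) = (\<Sum>a\<in>A. \<Sum>b\<in>B. \<Sum>i\<in>I. \<Sum>j\<in>J. f i j a b)"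
proof -
  have "(\<Sum>i\<in>I. \<Sum>j\<in>J. \<Sum>a\<in>A. \<Sum>b\<in>B. f i j a b) = (\<Sum>i\<in>I. \<Sum>a\<in>A. \<Sum>j\<in>J. \<Sum>b\<in>B. f i j a b)"
    by (intro sum.cong refl sum.swap)
  also have "\<dots> = (\<Sum>a\<in>A. \<Sum>i\<in>I. \<Sum>j\<in>J. \<Sum>b\<in>B. f i j a b)"
    by (rule sum.swap)
  also have "\<dots> = (\<Sum>a\<in>A. \<Sum>i\<in>I. \<Sum>b\<in>B. \<Sum>j\<in>J. f i j a b)"
    by (intro sum.cong refl sum.swap)
  also have "\<dots> = (\<Sum>a\<in>A. \<Sum>b\<in>B. \<Sum>i\<in>I. \<Sum>j\<in>J. f i j a b)"
    by (intro sum.cong refl sum.swap)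
  finally show ?thesis .
qed

text \<open>The form of the image at \<open>v\<close> is the form of \<open>X\<close> at
  \<open>w v\<close>, where \<open>w v\<close> applies the adjoint of \<open>V\<close> to each of
  the \<open>k\<close> blocks of \<open>v\<close>.\<close>

lemma completely_positive_kraus_map: "completely_positive n m (kraus_map V)"
  unfolding completely_positive_def k_positive_def
proof (intro allI impI)
  fix k X assume X: "psd (k * n) X"
  define Y where "Y = (\<lambda>p q. app n (kraus_map V)
    (\<lambda>i j. X (p div m * n + i) (q div m * n + j)) (p mod m) (q mod m))"
  define w where "w = (\<lambda>v r. \<Sum>i<m. cnj (V i (r mod n)) * v (r div n * m + i))"
  have block: "(\<Sum>i<m. \<Sum>j<m. cnj (v (c * m + i)) * Y (c * m + i) (d * m + j) * v (d * m + j)) =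
    (\<Sum>a<n. \<Sum>b<n. cnj (w v (c * n + a)) * X (c * n + a) (d * n + b) * w v (d * n + b))" for c d v
  proof -
    have "(\<Sum>i<m. \<Sum>j<m. cnj (v (c * m + i)) * Y (c * m + i) (d * m + j) * v (d * m + j)) =
      (\<Sum>i<m. \<Sum>j<m. \<Sum>a<n. \<Sum>b<n. V i a * cnj (v (c * m + i)) * X (c * n + a) (d * n + b) *
         (cnj (V j b) * v (d * m + j)))"
      unfolding Y_def app_def kraus_map_def sum_distrib_left sum_distrib_right
      by (intro sum.cong) (auto simp: mult_ac)
    also have "\<dots> = (\<Sum>a<n. \<Sum>b<n. \<Sum>i<m. \<Sum>j<m. V i a * cnj (v (c * m + i)) * X (c * n + a) (d * n + b) *
         (cnj (V j b) * v (d * m + j)))"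
      by (rule sum_swap_pairs)
    also have "\<dots> = (\<Sum>a<n. \<Sum>b<n. (\<Sum>i<m. V i a * cnj (v (c * m + i))) * X (c * n + a) (d * n + b) *
         (\<Sum>j<m. cnj (V j b) * v (d * m + j)))"
      by (simp only: sum_distrib_right) (simp only: sum_distrib_left)
    also have "\<dots> = (\<Sum>a<n. \<Sum>b<n. cnj (w v (c * n + a)) * X (c * n + a) (d * n + b) * w v (d * n + b))"
      by (intro sum.cong refl) (auto simp: w_def)
    finally show ?thesis .
  qed
  have "qform (k * m) Y v = qform (k * n) X (w v)" for v
    by (simp only: qform_blocks block)
  then show "psd (k * m) Y" using X unfolding psd_def by simp
qed

lemma completely_positive_add:
  assumes "completely_positive n m K" "completely_positive n m L"
  shows "completely_positive n m (lmap_add K L)"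
proof -
  have *: "qform l (\<lambda>p q. app n (lmap_add K L) (X p q) (f p) (g q)) v =
     qform l (\<lambda>p q. app n K (X p q) (f p) (g q)) v + qform l (\<lambda>p q. app n L (X p q) (f p) (g q)) v"
    for l X f g v
    by (simp add: qform_def app_def lmap_add_def algebra_simps sum.distrib)
  show ?thesis using assms
    unfolding completely_positive_def k_positive_def psd_def * by simp
qed

lemma completely_positive_scale:
  assumes "0 \<le> c" "completely_positive n m K"
  shows "completely_positive n m (lmap_scale c K)"
proof -
  have *: "qform l (\<lambda>p q. app n (lmap_scale c K) (X p q) (f p) (g q)) v =
     of_real c * qform l (\<lambda>p q. app n K (X p q) (f p) (g q)) v"
    for l X f g v
    by (simp add: qform_def app_def lmap_scale_def sum_distrib_left sum_distrib_right mult_ac)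
  show ?thesis using assms
    unfolding completely_positive_def k_positive_def psd_def * by simp
qed

lemma completely_positive_kraus_cone: "kraus_cone K \<Longrightarrow> completely_positive n m K"
  by (induction rule: kraus_cone.induct)
    (auto intro: completely_positive_kraus_map completely_positive_add completely_positive_scale)

section \<open>Choi pairing, and certificates for and against decomposability\<close>

definition pairing :: "nat \<Rightarrow> nat \<Rightarrow> lmap \<Rightarrow> lmap \<Rightarrow> complex" where
  "pairing n m W K = (\<Sum>a<n. \<Sum>b<n. \<Sum>i<m. \<Sum>j<m. W i j a b * K i j a b)"

text \<open>Evaluates the map on the unnormalised maximally entangled state, so that the
  pairing becomes a quadratic form of the Choi matrix.\<close>
lemma pairing_kraus_map_nonneg:
  assumes "completely_positive n m K"
  shows "0 \<le> Re (pairing n m (kraus_map V) K)"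
proof -
  define e where "e = (\<lambda>p. if p div n = p mod n then 1 else 0 :: complex)"
  have "psd (n * n) (\<lambda>p q. e p * cnj (e q))" by (rule psd_rank_one)
  then have psd: "psd (n * m) (\<lambda>p q. app n K (\<lambda>i j. e (p div m * n + i) * cnj (e (q div m * n + j)))
      (p mod m) (q mod m))" (is "psd _ ?Y")
    using assms unfolding completely_positive_def k_positive_def by blast
  have choi: "?Y (a * m + i) (b * m + j) = K i j a b" if "a < n" "b < n" "i < m" "j < m" for a b i j
  proof -
    have "?Y (a * m + i) (b * m + j) =
      (\<Sum>x<n. \<Sum>y<n. if y = b then (if x = a then K i j x y else 0) else 0)"
      unfolding app_def using that by (intro sum.cong) (auto simp: e_def)
    also have "\<dots> = K i j a b"
      using that by simp
    finally show ?thesis .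
  qed
  have "pairing n m (kraus_map V) K = qform (n * m) ?Y (\<lambda>p. cnj (V (p mod m) (p div m)))"
    unfolding qform_blocks pairing_def
    by (intro sum.cong refl) (simp only: choi lessThan_iff, simp add: kraus_map_def)
  then show ?thesis using psd unfolding psd_def by simp
qed

lemma pairing_nonneg:
  assumes "kraus_cone W" "completely_positive n m K"
  shows "0 \<le> Re (pairing n m W K)"
  using assms(1)
proof (induction rule: kraus_cone.induct)
  case (kraus V)
  then show ?case using pairing_kraus_map_nonneg[OF assms(2)] by blast
next
  case (add W W')
  moreover have "pairing n m (lmap_add W W') K = pairing n m W K + pairing n m W' K"
    by (simp add: pairing_def lmap_add_def algebra_simps sum.distrib)
  ultimately show ?case by simp
next
  case (scale c W)
  moreover have "pairing n m (lmap_scale c W) K = of_real c * pairing n m W K"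
    by (simp add: pairing_def lmap_scale_def sum_distrib_left mult_ac)
  ultimately show ?case by simp
qed

lemma app_unit_mat:
  assumes "a < n" "b < n"
  shows "app n K (unit_mat a b) i j = K i j a b"
proof -
  have "app n K (unit_mat a b) i j = (\<Sum>x<n. \<Sum>y<n. if y = b then (if x = a then K i j x y else 0) else 0)"
    unfolding app_def unit_mat_def by (intro sum.cong) auto
  then show ?thesis using assms by simp
qed

text \<open>Weak duality. The pairing has no conjugation, so the output transpose on
  \<open>S\<close> moves over to \<open>W\<close> and turns it into \<open>W'\<close>. Both parts of
  a decomposition then pair nonnegatively.\<close>

lemma not_decomposable_if_witness:
  assumes W: "kraus_cone W" and W': "kraus_cone W'"
    and transpose: "\<And>i j a b. i < m \<Longrightarrow> j < m \<Longrightarrow> a < n \<Longrightarrow> b < n \<Longrightarrow> W j i a b = W' i j a b"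
    and neg: "Re (pairing n m W K) < 0"
  shows "\<not> decomposable n m K"
proof
  assume "decomposable n m K"
  then obtain T S where T: "completely_positive n m T" and S: "completely_positive n m S"
    and eq: "\<And>X i j. i < m \<Longrightarrow> j < m \<Longrightarrow> app n K X i j = app n T X i j + app n S X j i"
    unfolding decomposable_def by blast
  have K: "K i j a b = T i j a b + S j i a b" if "i < m" "j < m" "a < n" "b < n" for i j a b
    using eq[OF that(1,2), of "unit_mat a b"] that by (simp add: app_unit_mat)
  have "pairing n m W K = pairing n m W T + (\<Sum>a<n. \<Sum>b<n. \<Sum>i<m. \<Sum>j<m. W i j a b * S j i a b)"
    unfolding pairing_def sum.distrib[symmetric]
    by (intro sum.cong refl) (simp add: K algebra_simps)
  also have "(\<Sum>a<n. \<Sum>b<n. \<Sum>i<m. \<Sum>j<m. W i j a b * S j i a b) =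
      (\<Sum>a<n. \<Sum>b<n. \<Sum>j<m. \<Sum>i<m. W i j a b * S j i a b)"
    by (intro sum.cong refl sum.swap)
  also have "\<dots> = pairing n m W' S"
    unfolding pairing_def by (intro sum.cong refl) (simp add: transpose)
  finally show False
    using neg pairing_nonneg[OF W T] pairing_nonneg[OF W' S] by simp
qed

lemma decomposable_if_kraus_cone:
  assumes T: "kraus_cone T" and S: "kraus_cone S"
    and K: "\<And>i j a b. i < m \<Longrightarrow> j < m \<Longrightarrow> a < n \<Longrightarrow> b < n \<Longrightarrow> K i j a b = T i j a b + S j i a b"
  shows "decomposable n m K"
  unfolding decomposable_def
proof (intro exI conjI allI impI)
  show "completely_positive n m T" "completely_positive n m S"
    using T S by (auto intro: completely_positive_kraus_cone)
  fix X i j assume "i < m" "j < m"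
  then show "app n K X i j = app n T X i j + app n S X j i"
    unfolding app_def sum.distrib[symmetric]
    by (intro sum.cong refl) (simp add: K algebra_simps)
qed

section \<open>Decomposability of the tensor product\<close>

text \<open>Conjugations by the Pauli matrices; the matrix of \<open>alt_k\<close> is the real form
  \<i> sigma_y. \<open>diag_k\<close> is the average of \<open>id_k\<close> and
  \<open>sgn_k\<close>, and \<open>flip_k\<close> that of \<open>sym_k\<close> and
  \<open>alt_k\<close>, so these two also have nonnegative Pauli weights.\<close>

definition id_k :: lmap where "id_k = kraus_map id_mat"
definition sgn_k :: lmap where "sgn_k = kraus_map (\<lambda>i j. unit_mat 0 0 i j - unit_mat 1 1 i j)"
definition sym_k :: lmap where "sym_k = kraus_map (\<lambda>i j. unit_mat 0 1 i j + unit_mat 1 0 i j)"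
definition alt_k :: lmap where "alt_k = kraus_map (\<lambda>i j. unit_mat 0 1 i j - unit_mat 1 0 i j)"
definition diag_k :: lmap where "diag_k = lmap_add (kraus_map (unit_mat 0 0)) (kraus_map (unit_mat 1 1))"
definition flip_k :: lmap where "flip_k = lmap_add (kraus_map (unit_mat 0 1)) (kraus_map (unit_mat 1 0))"

lemmas basic_kernel_defs = id_k_def sgn_k_def sym_k_def alt_k_def diag_k_def flip_k_def

lemma kraus_cone_basic:
  "kraus_cone id_k" "kraus_cone sgn_k" "kraus_cone sym_k" "kraus_cone alt_k"
  "kraus_cone diag_k" "kraus_cone flip_k"
  unfolding basic_kernel_defs by (intro kraus_cone.intros)+

lemma basic_kernel_simps:
  "id_k i j a b = (if i = a \<and> j = b then 1 else 0)"
  "sgn_k i j a b = ((if i = 0 \<and> a = 0 then 1 else 0) - (if i = 1 \<and> a = 1 then 1 else 0)) *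
     ((if j = 0 \<and> b = 0 then 1 else 0) - (if j = 1 \<and> b = 1 then 1 else 0))"
  "sym_k i j a b = ((if i = 0 \<and> a = 1 then 1 else 0) + (if i = 1 \<and> a = 0 then 1 else 0)) *
     ((if j = 0 \<and> b = 1 then 1 else 0) + (if j = 1 \<and> b = 0 then 1 else 0))"
  "alt_k i j a b = ((if i = 0 \<and> a = 1 then 1 else 0) - (if i = 1 \<and> a = 0 then 1 else 0)) *
     ((if j = 0 \<and> b = 1 then 1 else 0) - (if j = 1 \<and> b = 0 then 1 else 0))"
  "diag_k i j a b = (if i = 0 \<and> a = 0 \<and> j = 0 \<and> b = 0 then 1 else 0) +
     (if i = 1 \<and> a = 1 \<and> j = 1 \<and> b = 1 then 1 else 0)"
  "flip_k i j a b = (if i = 0 \<and> a = 1 \<and> j = 0 \<and> b = 1 then 1 else 0) +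
     (if i = 1 \<and> a = 0 \<and> j = 1 \<and> b = 0 then 1 else 0)"
  by (simp_all add: basic_kernel_defs kraus_map_def lmap_add_def id_mat_def unit_mat_def)

lemma sum_lessThan_2: "(\<Sum>i<2. f i) = f 0 + f (Suc 0)" for f :: "nat \<Rightarrow> 'a::comm_monoid_add"
  by (simp add: numeral_2_eq_2)

text \<open>The sum of \<open>diag_k\<close> and \<open>flip_k\<close> is the map sending X to Tr(X)
  times the identity.\<close>

lemma kernel_T_map:
  assumes "i < 2" "j < 2" "a < 2" "b < 2"
  shows "kernel_of (T_map t) i j a b =
    (1 - of_real t) / 2 * (diag_k i j a b + flip_k i j a b) + of_real t * id_k i j a b"
  using assms
  by (auto simp: less_2_cases_iff kernel_of_def T_map_def mtrace_def unit_mat_def id_mat_def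
      sum_lessThan_2 basic_kernel_simps)

text \<open>The terms with \<open>sigma2\<close> and \<open>sigma4\<close> together give twice the
  off-diagonal part of X, which is \<open>id_k\<close> minus \<open>diag_k\<close>.\<close>

lemma kernel_Pi_map:
  assumes "i < 2" "j < 2" "a < 2" "b < 2"
  shows "kernel_of (Pi_map c) i j a b =
    (diag_k i j a b + flip_k i j a b) / 2 + of_real c * (id_k i j a b - diag_k i j a b)"
  using assms
  by (auto simp: less_2_cases_iff kernel_of_def Pi_map_def mtrace_def mmult_def sigma2_def sigma4_def
      unit_mat_def id_mat_def sum_lessThan_2 basic_kernel_simps)

lemma TPi_eq:
  assumes "i < 4" "j < 4" "a < 4" "b < 4"
  shows "TPi t c i j a b =
    ((1 - of_real t) / 2 * (diag_k (i div 2) (j div 2) (a div 2) (b div 2) +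
       flip_k (i div 2) (j div 2) (a div 2) (b div 2)) +
     of_real t * id_k (i div 2) (j div 2) (a div 2) (b div 2)) *
    ((diag_k (i mod 2) (j mod 2) (a mod 2) (b mod 2) +
       flip_k (i mod 2) (j mod 2) (a mod 2) (b mod 2)) / 2 +
     of_real c * (id_k (i mod 2) (j mod 2) (a mod 2) (b mod 2) -
       diag_k (i mod 2) (j mod 2) (a mod 2) (b mod 2)))"
  unfolding TPi_def tensor_map_def using assms
  by (subst kernel_T_map kernel_Pi_map; simp add: div_less_iff_less_mult)+

text \<open>The coefficients solve the linear programme for Pauli-diagonal decompositions; the last
  three summands have their output indices transposed.\<close>
lemma bits_identity_large:
  fixes x y :: complex
  assumes "i < 2" "j < 2" "a < 2" "b < 2" "i' < 2" "j' < 2" "a' < 2" "b' < 2"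
  shows "((1 - x) / 2 * (diag_k i j a b + flip_k i j a b) + x * id_k i j a b) *
      ((diag_k i' j' a' b' + flip_k i' j' a' b') / 2 + y * (id_k i' j' a' b' - diag_k i' j' a' b')) =
    (3 - 2 * y + x + 2 * y * x) / 8 * (id_k i j a b * id_k i' j' a' b') +
    ((1 - x) * (2 * y - 1) / 8 * ((2 * flip_k i j a b + sgn_k i j a b) * id_k i' j' a' b') +
     (1 + x) * (1 - y) / 2 * (id_k i j a b * flip_k i' j' a' b')) +
    ((3 - x - 2 * y - 2 * y * x) / 8 * (alt_k j i a b * sym_k j' i' a' b') +
     ((1 + x) * (2 * y - 1) / 8 * ((2 * diag_k j i a b + sym_k j i a b) * sym_k j' i' a' b') +
      (1 - x) * (1 - y) / 2 * (alt_k j i a b * diag_k j' i' a' b')))"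
  using assms unfolding less_2_cases_iff
  by (elim disjE; simp add: basic_kernel_simps; simp add: field_simps)

text \<open>The dual solution of that linear programme: its partial transpose stays in the Kraus cone.\<close>
lemma bits_identity_witness:
  assumes "i < 2" "j < 2" "a < 2" "b < 2" "i' < 2" "j' < 2" "a' < 2" "b' < 2"
  shows "2 * ((id_k j i a b + (diag_k j i a b + flip_k j i a b)) * sgn_k j' i' a' b') +
     4 * ((2 * flip_k j i a b + sgn_k j i a b) * flip_k j' i' a' b') =
    2 * ((2 * diag_k i j a b + sym_k i j a b) * diag_k i' j' a' b') +
    (2 * ((2 * diag_k i j a b + sym_k i j a b) * alt_k i' j' a' b') +
     6 * (alt_k i j a b * flip_k i' j' a' b'))"
  using assms unfolding less_2_cases_iff
  by (elim disjE; simp add: basic_kernel_simps)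

lemma pairing_tensor:
  "pairing 4 4 (tensor_map 2 2 W W') (tensor_map 2 2 K K') = pairing 2 2 W K * pairing 2 2 W' K'"
proof -
  have four: "sum f {..<4::nat} = (\<Sum>i<2. \<Sum>j<2. f (i * 2 + j))" for f :: "nat \<Rightarrow> complex"
    using sum_lessThan_mult[of f 2 2] by simp
  show ?thesis
    unfolding pairing_def four tensor_map_def
    by (simp add: sum_lessThan_2 algebra_simps)
qed

lemma TPi_not_decomposable:
  fixes t c :: real
  assumes "3 < 2 * c + t + 2 * c * t"
  shows "\<not> decomposable 4 4 (TPi t c)"
proof (rule not_decomposable_if_witness)
  let ?W1 = "tensor_map 2 2 (lmap_add id_k (lmap_add diag_k flip_k)) sgn_k"
  let ?W2 = "tensor_map 2 2 (lmap_add (lmap_scale 2 flip_k) sgn_k) flip_k"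
  let ?W = "lmap_add (lmap_scale 2 ?W1) (lmap_scale 4 ?W2)"
  let ?W' = "lmap_add (lmap_scale 2 (tensor_map 2 2 (lmap_add (lmap_scale 2 diag_k) sym_k) diag_k))
    (lmap_add (lmap_scale 2 (tensor_map 2 2 (lmap_add (lmap_scale 2 diag_k) sym_k) alt_k))
      (lmap_scale 6 (tensor_map 2 2 alt_k flip_k)))"
  show "kraus_cone ?W" "kraus_cone ?W'"
    by (intro kraus_cone_tensor kraus_cone.intros kraus_cone_basic; simp)+
  show "?W j i a b = ?W' i j a b" if "i < 4" "j < 4" "a < 4" "b < 4" for i j a b
    using that bits_identity_witness[of "i div 2" "j div 2" "a div 2" "b div 2"
      "i mod 2" "j mod 2" "a mod 2" "b mod 2"]
    by (simp add: tensor_map_def lmap_add_def lmap_scale_def div_less_iff_less_mult)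
  let ?T = "kernel_of (T_map t)" and ?P = "kernel_of (Pi_map c)"
  \<comment> \<open>The pairing is multiplicative on tensor products, so the value is 2 (3 + 3t) (1
    - 2c) + 4 (3 - 3t).\<close>
  have "pairing 4 4 ?W K = 2 * pairing 4 4 ?W1 K + 4 * pairing 4 4 ?W2 K" for K
    by (simp add: pairing_def lmap_add_def lmap_scale_def sum_distrib_left algebra_simps sum.distrib)
  then have "pairing 4 4 ?W (TPi t c) =
    2 * (pairing 2 2 (lmap_add id_k (lmap_add diag_k flip_k)) ?T * pairing 2 2 sgn_k ?P) +
    4 * (pairing 2 2 (lmap_add (lmap_scale 2 flip_k) sgn_k) ?T * pairing 2 2 flip_k ?P)"
    by (simp add: TPi_def pairing_tensor)
  also have "pairing 2 2 (lmap_add id_k (lmap_add diag_k flip_k)) ?T = of_real (3 + 3 * t)"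
    by (simp add: pairing_def sum_lessThan_2 kernel_T_map lmap_add_def basic_kernel_simps field_simps)
  also have "pairing 2 2 (lmap_add (lmap_scale 2 flip_k) sgn_k) ?T = of_real (3 - 3 * t)"
    by (simp add: pairing_def sum_lessThan_2 kernel_T_map lmap_add_def lmap_scale_def basic_kernel_simps field_simps)
  also have "pairing 2 2 sgn_k ?P = of_real (1 - 2 * c)"
    by (simp add: pairing_def sum_lessThan_2 kernel_Pi_map basic_kernel_simps)
  also have "pairing 2 2 flip_k ?P = 1"
    by (simp add: pairing_def sum_lessThan_2 kernel_Pi_map basic_kernel_simps)
  finally have "pairing 4 4 ?W (TPi t c) = of_real (6 * (3 - t - 2 * c - 2 * c * t))"
    by (simp add: algebra_simps)
  moreover have "6 * (3 - t - 2 * c - 2 * c * t) < 0" using assms by (simp add: mult_less_0_iff)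
  ultimately show "Re (pairing 4 4 ?W (TPi t c)) < 0" by (simp only: Re_complex_of_real)
qed

text \<open>For \<open>c\<close> up to 1/2 the second factor is flip/2 + c id + (1/2 - c) diag with
  nonnegative weights. The tensor product is then itself completely positive, and the transposed
  summand is zero.\<close>

lemma TPi_decomposable_small:
  assumes "0 \<le> t" "t \<le> 1" "0 \<le> c" "c \<le> 1 / 2"
  shows "decomposable 4 4 (TPi t c)"
proof (rule decomposable_if_kraus_cone)
  show "kraus_cone (tensor_map 2 2
     (lmap_add (lmap_scale ((1 - t) / 2) (lmap_add diag_k flip_k)) (lmap_scale t id_k))
     (lmap_add (lmap_scale (1 / 2) flip_k) (lmap_add (lmap_scale c id_k) (lmap_scale (1 / 2 - c) diag_k))))"
    (is "kraus_cone ?T")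
    using assms by (intro kraus_cone_tensor kraus_cone.intros kraus_cone_basic) auto
  show "kraus_cone (lmap_scale 0 id_k)" by (intro kraus_cone.intros kraus_cone_basic) auto
  fix i j a b :: nat assume "i < 4" "j < 4" "a < 4" "b < 4"
  then show "TPi t c i j a b = ?T i j a b + lmap_scale 0 id_k j i a b"
    by (simp add: TPi_eq tensor_map_def lmap_add_def lmap_scale_def) (simp add: field_simps)
qed

text \<open>The weights come from \<open>bits_identity_large\<close>. The threshold hypothesis is
  exactly nonnegativity of the weight of \<open>alt_k\<close> tensor \<open>sym_k\<close>.\<close>

lemma TPi_decomposable_large:
  assumes "0 \<le> t" "t \<le> 1" "1 / 2 \<le> c" "c \<le> 1" "2 * c + t + 2 * c * t \<le> 3"
  shows "decomposable 4 4 (TPi t c)"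
proof (rule decomposable_if_kraus_cone)
  let ?T = "lmap_add (lmap_scale ((3 - 2 * c + t + 2 * c * t) / 8) (tensor_map 2 2 id_k id_k))
    (lmap_add (lmap_scale ((1 - t) * (2 * c - 1) / 8)
       (tensor_map 2 2 (lmap_add (lmap_scale 2 flip_k) sgn_k) id_k))
     (lmap_scale ((1 + t) * (1 - c) / 2) (tensor_map 2 2 id_k flip_k)))"
  let ?S = "lmap_add (lmap_scale ((3 - t - 2 * c - 2 * c * t) / 8) (tensor_map 2 2 alt_k sym_k))
    (lmap_add (lmap_scale ((1 + t) * (2 * c - 1) / 8)
       (tensor_map 2 2 (lmap_add (lmap_scale 2 diag_k) sym_k) sym_k))
     (lmap_scale ((1 - t) * (1 - c) / 2) (tensor_map 2 2 alt_k diag_k)))"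
  have "0 \<le> c * t" using assms by simp
  then have "0 \<le> 3 - 2 * c + t + 2 * c * t" using assms by linarith
  then show "kraus_cone ?T"
    using assms by (intro kraus_cone_tensor kraus_cone.intros kraus_cone_basic) auto
  show "kraus_cone ?S"
    using assms by (intro kraus_cone_tensor kraus_cone.intros kraus_cone_basic) auto
  fix i j a b :: nat assume "i < 4" "j < 4" "a < 4" "b < 4"
  then show "TPi t c i j a b = ?T i j a b + ?S j i a b"
    using bits_identity_large[of "i div 2" "j div 2" "a div 2" "b div 2"
      "i mod 2" "j mod 2" "a mod 2" "b mod 2" "of_real t" "of_real c"]
    by (simp add: TPi_eq tensor_map_def lmap_add_def lmap_scale_def div_less_iff_less_mult)
qed

section \<open>Positivity of the tensor product\<close>

text \<open>Splitting by the index of the second factor gives x = (z0, z2), y = (z1, z3), u = (v0,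
  v2), w = (v1, v3). Then \<alpha>, \<beta>, \<gamma>, \<delta> are <u,x>, <u,y>, <w,x>, <w,y>, and
  \<xi> is <y,x><u,w>.\<close>

lemma qform_TPi_rank_one:
  fixes z v :: "nat \<Rightarrow> complex"
  defines "\<alpha> \<equiv> cnj (v 0) * z 0 + cnj (v 2) * z 2" and "\<beta> \<equiv> cnj (v 0) * z 1 + cnj (v 2) * z 3"
    and "\<gamma> \<equiv> cnj (v 1) * z 0 + cnj (v 3) * z 2" and "\<delta> \<equiv> cnj (v 1) * z 1 + cnj (v 3) * z 3"
    and "\<xi> \<equiv> (z 0 * cnj (z 1) + z 2 * cnj (z 3)) * (cnj (v 0) * v 1 + cnj (v 2) * v 3)"
  shows "qform 4 (app 4 (TPi t c) (\<lambda>a b. z a * cnj (z b))) v = of_real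
    ((1 - t) / 4 * ((cmod (z 0))\<^sup>2 + (cmod (z 1))\<^sup>2 + (cmod (z 2))\<^sup>2 + (cmod (z 3))\<^sup>2) *
        ((cmod (v 0))\<^sup>2 + (cmod (v 1))\<^sup>2 + (cmod (v 2))\<^sup>2 + (cmod (v 3))\<^sup>2) +
     t / 2 * ((cmod \<alpha>)\<^sup>2 + (cmod \<beta>)\<^sup>2 + (cmod \<gamma>)\<^sup>2 + (cmod \<delta>)\<^sup>2) +
     c * ((1 - t) * Re \<xi> + 2 * t * Re (\<alpha> * cnj \<delta>)))"
proof -
  have four: "sum f {..<4::nat} = f 0 + f 1 + f 2 + f 3" for f :: "nat \<Rightarrow> complex"
    by (simp add: eval_nat_numeral)
  have re: "complex_of_real (Re w) = (w + cnj w) / 2" for w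
    by (simp add: complex_eq_iff)
  show ?thesis
    unfolding of_real_add of_real_mult re complex_norm_square qform_def app_def four
      \<alpha>_def \<beta>_def \<gamma>_def \<delta>_def \<xi>_def
    by (simp add: TPi_eq basic_kernel_simps) (simp add: field_simps)
qed

lemma lagrange_identity:
  "(cmod (a * cnj c + b * cnj d))\<^sup>2 + (cmod (a * d - b * c))\<^sup>2 =
    ((cmod a)\<^sup>2 + (cmod b)\<^sup>2) * ((cmod c)\<^sup>2 + (cmod d)\<^sup>2)"
  by (simp add: cmod_power2) (simp add: power2_eq_square algebra_simps)

text \<open>Replacing \<open>NM\<close> and \<open>S\<close> by their lower bounds leaves
  (1-t)(1-c)G plus a term free of \<open>G\<close>, which is treated by comparing \<open>p\<close>
  with \<open>D\<close>.\<close>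

lemma TPi_bound:
  fixes p q G D :: real
  assumes "0 \<le> t" "t \<le> 1" "0 \<le> c" "c \<le> 1" "2 * c * t \<le> 1"
    and nonneg: "0 \<le> p" "0 \<le> q" "0 \<le> G" "0 \<le> D"
    and p: "p \<le> q + D" and NM: "4 * (G + D) \<le> NM" and S: "2 * p + 2 * q \<le> S"
  shows "0 \<le> (1 - t) / 4 * NM + t / 2 * S - c * ((1 - t) * G + 2 * t * p)"
proof -
  have "G + D \<le> NM / 4" using NM by simp
  then have "(1 - t) * (G + D) \<le> (1 - t) * (NM / 4)"
    using assms by (intro mult_left_mono) auto
  then have "(1 - t) * (G + D) \<le> (1 - t) / 4 * NM" by simp
  moreover have "t * (p + q) \<le> t / 2 * S"
    using mult_left_mono[OF S, of "t / 2"] assms by (simp add: algebra_simps)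
  moreover have "0 \<le> (1 - t) * ((1 - c) * G)"
    using assms by simp
  moreover have "0 \<le> (1 - t) * D + t * (p + q) - 2 * c * t * p"
  proof (cases "p \<le> D")
    case True
    have "(1 - t) * p \<le> (1 - t) * D" using True assms by (intro mult_left_mono) auto
    moreover have "0 \<le> t * q" using assms by simp
    moreover have "2 * c * t * p \<le> 1 * p" using assms by (intro mult_right_mono) auto
    ultimately show ?thesis by (simp add: algebra_simps)
  next
    case False
    \<comment> \<open>The bound q >= p - D leaves (1-2t)D + 2t(1-c)p. Only for t > 1/2 is the first
      summand possibly negative, and then D < p bounds the total below by (1 - 2ct)p.\<close>
    have "t * (p - D) \<le> t * q" using p assms by (intro mult_left_mono) auto
    moreover have "0 \<le> (1 - 2 * t) * D + 2 * t * (1 - c) * p"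
    proof (cases "t \<le> 1 / 2")
      case True
      then show ?thesis using assms by simp
    next
      case t: False
      have "(2 * t - 1) * D \<le> (2 * t - 1) * p" using t False by (intro mult_left_mono) auto
      moreover have "2 * c * t * p \<le> 1 * p" using assms by (intro mult_right_mono) auto
      ultimately show ?thesis by (simp add: algebra_simps)
    qed
    ultimately show ?thesis by (simp add: algebra_simps)
  qed
  moreover have "(1 - t) * (G + D) + t * (p + q) - c * ((1 - t) * G + 2 * t * p) =
    (1 - t) * ((1 - c) * G) + ((1 - t) * D + t * (p + q) - 2 * c * t * p)"
    by (simp add: algebra_simps)
  ultimately show ?thesis by linarith
qed

text \<open>Cauchy-Schwarz for (g, d) and (g', d'), with its exact remainder, followed by 4XY <=
  (X+Y)^2 and its analogue for U and W.\<close>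

lemma four_products_le:
  fixes X Y U W :: real
  assumes "0 \<le> X" "0 \<le> Y" "0 \<le> U" "0 \<le> W"
    and eq: "g\<^sup>2 + d\<^sup>2 = X * Y" "g'\<^sup>2 + d'\<^sup>2 = U * W"
  shows "4 * (g * g' + d * d') \<le> (X + Y) * (U + W)"
proof (rule power2_le_imp_le)
  have "(g * g' + d * d')\<^sup>2 + (g * d' - d * g')\<^sup>2 = (X * Y) * (U * W)"
    unfolding eq[symmetric] by (simp add: power2_eq_square algebra_simps)
  then have "(g * g' + d * d')\<^sup>2 \<le> (X * Y) * (U * W)"
    using zero_le_power2[of "g * d' - d * g'"] by linarith
  moreover have "(4 * (g * g' + d * d'))\<^sup>2 = 16 * (g * g' + d * d')\<^sup>2"
    unfolding power_mult_distrib by simp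
  ultimately have "(4 * (g * g' + d * d'))\<^sup>2 \<le> (4 * (X * Y)) * (4 * (U * W))"
    by simp
  also have "\<dots> \<le> (X + Y)\<^sup>2 * (U + W)\<^sup>2"
  proof (rule mult_mono)
    show "4 * (X * Y) \<le> (X + Y)\<^sup>2" "4 * (U * W) \<le> (U + W)\<^sup>2"
      using zero_le_power2[of "X - Y"] zero_le_power2[of "U - W"]
      by (simp_all add: power2_eq_square algebra_simps)
  qed (use assms in auto)
  finally show "(4 * (g * g' + d * d'))\<^sup>2 \<le> ((X + Y) * (U + W))\<^sup>2"
    by (simp add: power_mult_distrib)
qed (use assms in auto)

lemma TPi_positive:
  assumes "0 \<le> t" "t \<le> 1" "0 \<le> c" "c \<le> 1" "2 * c * t \<le> 1"
  shows "positive_map 4 4 (TPi t c)"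
proof (rule positive_map_if_rank_one)
  fix z :: "nat \<Rightarrow> complex"
  show "psd 4 (app 4 (TPi t c) (\<lambda>a b. z a * cnj (z b)))"
    unfolding psd_def
  proof
    fix v :: "nat \<Rightarrow> complex"
    define \<alpha> \<beta> \<gamma> \<delta> where inner: "\<alpha> = cnj (v 0) * z 0 + cnj (v 2) * z 2" "\<beta> = cnj (v 0) * z 1 + cnj (v 2) * z 3"
      "\<gamma> = cnj (v 1) * z 0 + cnj (v 3) * z 2" "\<delta> = cnj (v 1) * z 1 + cnj (v 3) * z 3"
    \<comment> \<open>On \<open>z\<close> these are <y,x> and det(x,y); on \<open>v\<close> they are
      <w,u> and det(u,w).\<close>
    define g where "g = (\<lambda>w::nat \<Rightarrow> complex. w 0 * cnj (w 1) + w 2 * cnj (w 3))"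
    define d where "d = (\<lambda>w::nat \<Rightarrow> complex. w 0 * w 3 - w 2 * w 1)"
    define \<xi> where "\<xi> = (z 0 * cnj (z 1) + z 2 * cnj (z 3)) * (cnj (v 0) * v 1 + cnj (v 2) * v 3)"
    have \<xi>: "\<xi> = g z * cnj (g v)" by (simp add: \<xi>_def g_def)
    define p q G D where "p = cmod \<alpha> * cmod \<delta>" "q = cmod \<beta> * cmod \<gamma>"
      "G = cmod (g z) * cmod (g v)" "D = cmod (d z) * cmod (d v)"
    note pqGD = this
    define N where "N = (\<lambda>w::nat \<Rightarrow> complex. (cmod (w 0))\<^sup>2 + (cmod (w 1))\<^sup>2 + (cmod (w 2))\<^sup>2 + (cmod (w 3))\<^sup>2)"
    define S where "S = (cmod \<alpha>)\<^sup>2 + (cmod \<beta>)\<^sup>2 + (cmod \<gamma>)\<^sup>2 + (cmod \<delta>)\<^sup>2"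
    \<comment> \<open>Cauchy-Binet for the 2x2 matrix of inner products of u, w with x, y.\<close>
    have "\<alpha> * \<delta> = \<beta> * \<gamma> + d z * cnj (d v)"
      by (simp add: inner d_def algebra_simps)
    then have "p \<le> q + D"
      using norm_triangle_ineq[of "\<beta> * \<gamma>" "d z * cnj (d v)"] unfolding pqGD
      by (metis norm_mult complex_mod_cnj)
    moreover have "4 * (G + D) \<le> N z * N v"
      using four_products_le[of "(cmod (z 0))\<^sup>2 + (cmod (z 2))\<^sup>2" "(cmod (z 1))\<^sup>2 + (cmod (z 3))\<^sup>2"
          "(cmod (v 0))\<^sup>2 + (cmod (v 2))\<^sup>2" "(cmod (v 1))\<^sup>2 + (cmod (v 3))\<^sup>2"
          "cmod (g z)" "cmod (d z)" "cmod (g v)" "cmod (d v)"]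
        lagrange_identity[of "z 0" "z 1" "z 2" "z 3"] lagrange_identity[of "v 0" "v 1" "v 2" "v 3"]
      by (simp add: g_def d_def N_def pqGD add_ac)
    moreover have "2 * p + 2 * q \<le> S"
      using zero_le_power2[of "cmod \<alpha> - cmod \<delta>"] zero_le_power2[of "cmod \<beta> - cmod \<gamma>"]
      unfolding S_def pqGD power2_diff by linarith
    moreover have "0 \<le> p" "0 \<le> q" "0 \<le> G" "0 \<le> D" by (simp_all add: pqGD)
    ultimately have "0 \<le> (1 - t) / 4 * (N z * N v) + t / 2 * S - c * ((1 - t) * G + 2 * t * p)"
      using assms by (intro TPi_bound[of t c p q G D]) auto
    \<comment> \<open>The phases of both cross terms are replaced by the worst case, in which each
      real part is minus the modulus.\<close>
    also have "\<dots> \<le> (1 - t) / 4 * (N z * N v) + t / 2 * S + c * ((1 - t) * Re \<xi> + 2 * t * Re (\<alpha> * cnj \<delta>))"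
    proof -
      have "- G \<le> Re \<xi>" "- p \<le> Re (\<alpha> * cnj \<delta>)"
        using abs_Re_le_cmod[of \<xi>] abs_Re_le_cmod[of "\<alpha> * cnj \<delta>"]
        by (simp_all add: \<xi> pqGD norm_mult)
      then have "(1 - t) * - G + 2 * t * - p \<le> (1 - t) * Re \<xi> + 2 * t * Re (\<alpha> * cnj \<delta>)"
        using assms by (intro add_mono mult_left_mono) auto
      then have "c * ((1 - t) * - G + 2 * t * - p) \<le> c * ((1 - t) * Re \<xi> + 2 * t * Re (\<alpha> * cnj \<delta>))"
        using assms by (intro mult_left_mono)
      then show ?thesis by (simp add: algebra_simps)
    qed
    finally show "Im (qform 4 (app 4 (TPi t c) (\<lambda>a b. z a * cnj (z b))) v) = 0 \<and>
        0 \<le> Re (qform 4 (app 4 (TPi t c) (\<lambda>a b. z a * cnj (z b))) v)"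
      unfolding qform_TPi_rank_one inner[symmetric] \<xi>_def[symmetric]
      by (simp add: N_def S_def mult.assoc)
  qed
qed

lemma TPi_positive_imp:
  assumes "positive_map 4 4 (TPi t c)"
  shows "2 * c * t \<le> 1"
proof -
  \<comment> \<open>Two orthogonal maximally entangled vectors. They make the bounds assumed in
    \<open>TPi_bound\<close> equalities, with p = D = 1 and q = G = 0.\<close>
  define z v :: "nat \<Rightarrow> complex"
    where "z = (\<lambda>i. if i = 0 \<or> i = 3 then 1 else 0)"
      and "v = (\<lambda>i. if i = 0 then 1 else if i = 3 then - 1 else 0)"
  have "0 \<le> Re (qform 4 (app 4 (TPi t c) (\<lambda>a b. z a * cnj (z b))) v)"
    using assms psd_rank_one[of 4 z] unfolding positive_map_def psd_def by blast
  also have "\<dots> = 1 - 2 * c * t"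
    unfolding qform_TPi_rank_one by (simp add: z_def v_def field_simps)
  finally show ?thesis by simp
qed

theorem mainTheorem18:
  fixes t b :: real
  assumes "0 \<le> t" "t \<le> 1" "0 \<le> b" "b \<le> 1"
  shows "((positive_map 4 4 (TPi t b) \<and> \<not> decomposable 4 4 (TPi t b))
            \<longleftrightarrow> (2 * b * t \<le> 1 \<and> 3 < 2 * b + t + 2 * b * t))
         \<and> (positive_map 4 4 (TPi t b) \<longleftrightarrow> 2 * b * t \<le> 1)"
proof -
  have "positive_map 4 4 (TPi t b) \<longleftrightarrow> 2 * b * t \<le> 1"
    using TPi_positive TPi_positive_imp assms by blast
  \<comment> \<open>For \<open>b\<close> up to 1/2 the map is always decomposable, and
    \<open>TPi_not_decomposable\<close> then forces the inequality.\<close>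
  moreover have "decomposable 4 4 (TPi t b) \<longleftrightarrow> 2 * b + t + 2 * b * t \<le> 3"
    using TPi_not_decomposable[of b t] TPi_decomposable_small[of t b] TPi_decomposable_large[of t b] assms
    by (cases "b \<le> 1 / 2") (auto simp: not_less[symmetric])
  ultimately show ?thesis by auto
qed

end
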